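(* Among all $n$-tournaments, the Rényi $2$-entropy $H_2$ and the Rényi $3$-entropy $H_3$ are maximized by regular $n$-tournaments when $n$ is odd, and otherwise (when $n$ is even) by nearly-regular $n$-tournaments.
   Context: An $n$-tournament $T$ is a directed graph on $n$ vertices $v_1,\dots,v_n$ without loops such that for each pair of distinct vertices $x,y$ exactly one of the arcs $x\to y$, $y\to x$ is present. The score (out-degree) $d^+(v)$ of a vertex $v$ is the number of arcs with tail $v$. The normalized Laplacian of $T$ is $\overline{L}_T=\binom{n}{2}^{-1}(D-A)$, where $A$ is the adjacency matrix ($A(i,j)=1$ if $v_i\to v_j$, and $0$ otherwise) and $D$ is the diagonal matrix of out-degrees; $\Lambda_T$ is its spectrum (the multiset of its eigenvalues). For an integer $\alpha\ge 2$, the Rényi $\alpha$-entropy of $T$ is $H_\alpha(T)=\frac{1}{1-\alpha}\log_2\left(\sum_{\lambda\in\Lambda_T}\lambda^\alpha\right)$; it is not defined when the sum is $0$, as happens for $\alpha=3$ and $T$ the cyclic $3$-tournament. For $n$ odd, $T$ is regular if every vertex has score $\frac{n-1}{2}$. For $n$ even, $T$ is nearly-regular if $\frac n2$ of its vertices have score $\frac n2-1$ and the other $\frac n2$ have score $\frac n2$.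
   Formalization: The claim is for n ≥ 2, and for H_3 the case n = 3 is excluded: the normalized Laplacian is undefined for n < 2, and the only regular 3-tournament, the cyclic one, has power sum 0, so its H_3 is undefined. *)

theory Defs
  imports
    Complex_Main
    "HOL-Library.Multiset"
    "HOL-Computational_Algebra.Polynomial"
    "Jordan_Normal_Form.Char_Poly"
    "Graph_Theory.Pair_Digraph"
begin

(* The vertices v_1, ..., v_n are the indices 0, ..., n - 1, so that they also index the rows
   and columns of the matrices below.  pair_digraph: finite, loop-free, arcs between vertices. *)
definition n_tournament :: "nat \<Rightarrow> nat pair_pre_digraph \<Rightarrow> bool" where
  "n_tournament n T \<longleftrightarrow>
     pair_digraph T \<and> pverts T = {..<n} \<and>
     (\<forall>x \<in> pverts T. \<forall>y \<in> pverts T. x \<noteq> y \<longrightarrow> ((x, y) \<in> parcs T) \<noteq> ((y, x) \<in> parcs T))"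

definition score :: "nat pair_pre_digraph \<Rightarrow> nat \<Rightarrow> nat" where
  "score T v = out_degree (with_proj T) v"

definition regular_tournament :: "nat \<Rightarrow> nat pair_pre_digraph \<Rightarrow> bool" where
  "regular_tournament n T \<longleftrightarrow>
     n_tournament n T \<and> odd n \<and> (\<forall>v \<in> pverts T. score T v = (n - 1) div 2)"

definition nearly_regular_tournament :: "nat \<Rightarrow> nat pair_pre_digraph \<Rightarrow> bool" where
  "nearly_regular_tournament n T \<longleftrightarrow>
     n_tournament n T \<and> even n \<and>
     card {v \<in> pverts T. score T v = n div 2 - 1} = n div 2 \<and>
     card {v \<in> pverts T. score T v = n div 2} = n div 2"

definition adjacency_mat :: "nat \<Rightarrow> nat pair_pre_digraph \<Rightarrow> real mat" where
  "adjacency_mat n T = mat n n (\<lambda>(i, j). if (i, j) \<in> parcs T then 1 else 0)"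

definition score_mat :: "nat \<Rightarrow> nat pair_pre_digraph \<Rightarrow> real mat" where
  "score_mat n T = mat n n (\<lambda>(i, j). if i = j then real (score T i) else 0)"

definition normalized_laplacian :: "nat \<Rightarrow> nat pair_pre_digraph \<Rightarrow> real mat" where
  "normalized_laplacian n T = inverse (real (n choose 2)) \<cdot>\<^sub>m (score_mat n T - adjacency_mat n T)"

(* The eigenvalues may be non-real; they are counted with algebraic multiplicity. *)
definition laplacian_spectrum :: "nat \<Rightarrow> nat pair_pre_digraph \<Rightarrow> complex multiset" where
  "laplacian_spectrum n T = proots (char_poly (map_mat complex_of_real (normalized_laplacian n T)))"

definition spectral_power_sum :: "nat \<Rightarrow> nat \<Rightarrow> nat pair_pre_digraph \<Rightarrow> complex" where
  "spectral_power_sum \<alpha> n T = (\<Sum>z \<in># laplacian_spectrum n T. z ^ \<alpha>)"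

(* The cyclic 3-tournament is the case where this fails for exponent 3: its power sum is 0. *)
definition renyi_defined :: "nat \<Rightarrow> nat \<Rightarrow> nat pair_pre_digraph \<Rightarrow> bool" where
  "renyi_defined \<alpha> n T \<longleftrightarrow> spectral_power_sum \<alpha> n T \<in> \<real> \<and> 0 < Re (spectral_power_sum \<alpha> n T)"

(* Only meaningful where renyi_defined holds: log 2 0 = 0 by convention. The real part is taken
   only for typing, since renyi_defined requires the power sum to be real. *)
definition renyi_entropy :: "nat \<Rightarrow> nat \<Rightarrow> nat pair_pre_digraph \<Rightarrow> real" where
  "renyi_entropy \<alpha> n T = 1 / (1 - real \<alpha>) * log 2 (Re (spectral_power_sum \<alpha> n T))"

definition maximizes_renyi_entropy :: "nat \<Rightarrow> nat \<Rightarrow> nat pair_pre_digraph \<Rightarrow> bool" where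
  "maximizes_renyi_entropy \<alpha> n T \<longleftrightarrow>
     n_tournament n T \<and> renyi_defined \<alpha> n T \<and>
     (\<forall>S. n_tournament n S \<longrightarrow>
        renyi_defined \<alpha> n S \<and> renyi_entropy \<alpha> n S \<le> renyi_entropy \<alpha> n T)"

end

theory Submission
  imports Defs "Jordan_Normal_Form.Schur_Decomposition"
begin

text \<open>
  The sum of the \<open>k\<close>-th powers of the eigenvalues is the trace of the \<open>k\<close>-th power of the matrix.
  For the Laplacian \<open>D - A\<close> of a tournament with scores \<open>d\<close>, the mixed terms vanish because
  \<open>A\<close> and \<open>A\<^sup>2\<close> have zero diagonal, so the traces are the sum of the \<open>d\<^sup>2\<close> and the sum of the
  \<open>d\<^sup>3\<close> minus \<open>tr A\<^sup>3\<close>. The latter counts cyclic triangles, which the scores determine. Both traces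
  are thus sums of a convex function of the scores plus a constant; as the scores are integers with
  a fixed sum, such a sum is smallest when they take only two consecutive values.
\<close>

section \<open>Traces and power sums of eigenvalues\<close>

definition mat_trace :: "'a :: comm_monoid_add mat \<Rightarrow> 'a" where
  "mat_trace A = (\<Sum>i<dim_row A. A $$ (i, i))"

lemma mat_mult_entry:
  assumes "A \<in> carrier_mat n m" "B \<in> carrier_mat m p" "i < n" "j < p"
  shows "(A * B) $$ (i, j) = (\<Sum>k<m. A $$ (i, k) * B $$ (k, j))"
  using assms by (auto simp: scalar_prod_def atLeast0LessThan intro!: sum.cong)

lemma mat_trace_mult_commute:
  fixes A B :: "'a :: comm_semiring_0 mat"
  assumes A: "A \<in> carrier_mat n m" and B: "B \<in> carrier_mat m n"
  shows "mat_trace (A * B) = mat_trace (B * A)"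
proof -
  have "mat_trace (A * B) = (\<Sum>i<n. \<Sum>k<m. A $$ (i, k) * B $$ (k, i))"
    using A by (auto simp: mat_trace_def mat_mult_entry[OF A B] simp del: index_mult_mat(1)
        intro!: sum.cong)
  also have "\<dots> = (\<Sum>k<m. \<Sum>i<n. B $$ (k, i) * A $$ (i, k))"
    by (subst sum.swap) (simp add: mult.commute)
  also have "\<dots> = mat_trace (B * A)"
    using B by (auto simp: mat_trace_def mat_mult_entry[OF B A] simp del: index_mult_mat(1)
        intro!: sum.cong)
  finally show ?thesis .
qed

text \<open>Cyclicity of the trace moves \<open>Q\<close> to the front, where it cancels against
  \<open>P\<close>.\<close>

lemma mat_trace_similar:
  fixes A B :: "'a :: comm_semiring_1 mat"
  assumes "similar_mat_wit A B P Q"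
  shows "mat_trace A = mat_trace B"
proof -
  define n where "n = dim_row A"
  have A: "A = P * B * Q" and QP: "Q * P = 1\<^sub>m n"
    and c: "B \<in> carrier_mat n n" "P \<in> carrier_mat n n" "Q \<in> carrier_mat n n"
    using similar_mat_witD[OF n_def assms] by blast+
  have "mat_trace A = mat_trace (Q * (P * B))"
    unfolding A by (rule mat_trace_mult_commute[of _ n n]) (use c in auto)
  also have "Q * (P * B) = (Q * P) * B"
    using c by (simp add: assoc_mult_mat[of _ n n _ n _ n])
  finally show ?thesis using c by (simp add: QP)
qed

text \<open>In the sum for entry \<open>(i, j)\<close> of \<open>B ^\<^sub>m k * B\<close>, term
  \<open>l\<close> can survive only if i \<le> l \<le> j: no term for j < i, and only l = i for j =
  i. The claims share one induction because the diagonal step also uses triangularity of the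
  previous power.\<close>

lemma upper_triangular_pow:
  fixes B :: "'a :: comm_semiring_1 mat"
  assumes B: "B \<in> carrier_mat n n" and ut: "upper_triangular B"
  shows "upper_triangular (B ^\<^sub>m k) \<and> (\<forall>i<n. (B ^\<^sub>m k) $$ (i, i) = (B $$ (i, i)) ^ k)"
proof (induction k)
  case 0
  then show ?case using B by (auto simp: upper_triangular_def)
next
  case (Suc k)
  have C: "B ^\<^sub>m k \<in> carrier_mat n n" using B by simp
  have utC: "(B ^\<^sub>m k) $$ (i, j) = 0" if "j < i" "i < n" for i j
    using Suc C that by (auto simp: upper_triangular_def)
  have utB: "B $$ (i, j) = 0" if "j < i" "i < n" for i j
    using ut B that by (auto simp: upper_triangular_def)
  have entry: "(B ^\<^sub>m Suc k) $$ (i, j) = (\<Sum>l<n. (B ^\<^sub>m k) $$ (i, l) * B $$ (l, j))"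
    if "i < n" "j < n" for i j
    using mat_mult_entry[OF C B that] by simp
  have low: "(B ^\<^sub>m Suc k) $$ (i, j) = 0" if "j < i" "i < n" for i j
  proof -
    have "(B ^\<^sub>m k) $$ (i, l) * B $$ (l, j) = 0" if "l < n" for l
      using utC[of l i] utB[of j l] \<open>j < i\<close> \<open>i < n\<close> that by (cases "l < i") auto
    then show ?thesis using that by (simp add: entry del: pow_mat.simps)
  qed
  have diag: "(B ^\<^sub>m Suc k) $$ (i, i) = (B $$ (i, i)) ^ Suc k" if "i < n" for i
  proof -
    have "(B ^\<^sub>m k) $$ (i, l) * B $$ (l, i) = (if l = i then (B $$ (i, i)) ^ Suc k else 0)"
      if "l < n" for l
      using utC[of l i] utB[of i l] Suc \<open>i < n\<close> that
      by (cases l i rule: linorder_cases) (auto simp: mult.commute)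
    then show ?thesis using that by (simp add: entry del: pow_mat.simps)
  qed
  show ?case using low diag B by (auto simp: upper_triangular_def simp del: pow_mat.simps)
qed

lemma proots_prod_list_linear: "proots (\<Prod>a\<leftarrow>as. [:- a, 1:]) = mset (as :: 'a :: idom list)"
proof (induction as)
  case (Cons a as)
  have "(\<Prod>a\<leftarrow>as. [:- a, 1:]) \<noteq> 0" by (auto simp: prod_list_zero_iff)
  then have "proots ([:- a, 1:] * (\<Prod>a\<leftarrow>as. [:- a, 1:])) = {#a#} + mset as"
    using Cons.IH by (subst proots_mult) auto
  then show ?case by simp
qed simp

text \<open>Schur triangularisation makes \<open>A\<close> similar to an upper triangular
  \<open>B\<close> whose diagonal lists the roots of the characteristic polynomial with
  multiplicity; both similarity and triangularity pass to powers.\<close>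

lemma sum_proots_char_poly_power:
  fixes A :: "complex mat"
  assumes A: "A \<in> carrier_mat n n"
  shows "(\<Sum>z\<in>#proots (char_poly A). z ^ k) = mat_trace (A ^\<^sub>m k)"
proof -
  obtain as where as: "char_poly A = (\<Prod>a\<leftarrow>as. [:- a, 1:])"
    using char_poly_factorized[OF A] by blast
  obtain B P Q where "schur_decomposition A as = (B, P, Q)"
    by (cases "schur_decomposition A as") auto
  from schur_decomposition[OF A as this]
  have sim: "similar_mat_wit A B P Q" and ut: "upper_triangular B" and diag: "diag_mat B = as"
    by auto
  have B: "B \<in> carrier_mat n n" using similar_mat_witD2[OF A sim] by simp
  have "mat_trace (A ^\<^sub>m k) = mat_trace (B ^\<^sub>m k)"
    by (rule mat_trace_similar[OF similar_mat_wit_pow[OF sim]])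
  also have "\<dots> = (\<Sum>i<n. (B $$ (i, i)) ^ k)"
    using upper_triangular_pow[OF B ut, of k] B by (simp add: mat_trace_def)
  also have "\<dots> = (\<Sum>a\<leftarrow>as. a ^ k)"
    using B by (simp add: diag[symmetric] diag_mat_def comp_def interv_sum_list_conv_sum_set_nat
        atLeast0LessThan)
  also have "\<dots> = (\<Sum>z\<in>#proots (char_poly A). z ^ k)"
    by (simp add: as proots_prod_list_linear flip: sum_mset_sum_list)
  finally show ?thesis ..
qed

text \<open>The embedding commutes with matrix powers, so the power sum is real even when single
  eigenvalues are not. This gives the reality condition in \<open>renyi_defined\<close>.\<close>

lemma sum_proots_char_poly_power_real:
  fixes A :: "real mat"
  assumes A: "A \<in> carrier_mat n n"
  shows "(\<Sum>z\<in>#proots (char_poly (map_mat complex_of_real A)). z ^ k) =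
    complex_of_real (mat_trace (A ^\<^sub>m k))"
  using A by (simp add: sum_proots_char_poly_power[of _ n] mat_trace_def
      flip: of_real_hom.mat_hom_pow[OF A])

lemma mat_trace_pow2:
  fixes M :: "'a :: comm_semiring_1 mat"
  assumes M: "M \<in> carrier_mat n n"
  shows "mat_trace (M ^\<^sub>m 2) = (\<Sum>i<n. \<Sum>j<n. M $$ (i, j) * M $$ (j, i))"
  using M by (simp add: numeral_2_eq_2 mat_trace_def mat_mult_entry[OF M M] del: index_mult_mat(1))

lemma mat_trace_pow3:
  fixes M :: "'a :: comm_semiring_1 mat"
  assumes M: "M \<in> carrier_mat n n"
  shows "mat_trace (M ^\<^sub>m 3) =
    (\<Sum>i<n. \<Sum>j<n. \<Sum>k<n. M $$ (i, j) * M $$ (j, k) * M $$ (k, i))"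
proof -
  have MM: "M * M \<in> carrier_mat n n" using M by simp
  have "M ^\<^sub>m 3 = M * M * M"
    using M by (simp add: numeral_3_eq_3 del: assoc_mult_mat)
  then have "mat_trace (M ^\<^sub>m 3) =
      (\<Sum>i<n. \<Sum>k<n. \<Sum>j<n. M $$ (i, j) * M $$ (j, k) * M $$ (k, i))"
    using M by (simp add: mat_trace_def mat_mult_entry[OF M M] sum_distrib_right
        mat_mult_entry[OF MM M] del: index_mult_mat(1) assoc_mult_mat)
  also have "\<dots> = (\<Sum>i<n. \<Sum>j<n. \<Sum>k<n. M $$ (i, j) * M $$ (j, k) * M $$ (k, i))"
    by (intro sum.cong refl sum.swap)
  finally show ?thesis .
qed

section \<open>The Laplacian of a tournament\<close>

text \<open>With arcs as 0-1 weights, counting vertex configurations becomes arithmetic on products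
  of weights.\<close>

locale tournament_weights =
  fixes n :: nat and a :: "nat \<Rightarrow> nat \<Rightarrow> real" and d :: "nat \<Rightarrow> real"
  assumes a_01: "a i j = 0 \<or> a i j = 1"
    and a_diag: "a i i = 0"
    and a_total: "i < n \<Longrightarrow> j < n \<Longrightarrow> a i j + a j i = (if i = j then 0 else 1)"
    and d_def: "i < n \<Longrightarrow> d i = (\<Sum>j<n. a i j)"
begin

lemma a_idem: "a i j * a i j = a i j"
  using a_01[of i j] by auto

lemma a_flip: "i < n \<Longrightarrow> j < n \<Longrightarrow> a j i = 1 - (if i = j then 1 else 0) - a i j"
  using a_total[of i j] by (auto split: if_splits)

lemma a_asym: "i < n \<Longrightarrow> j < n \<Longrightarrow> a i j * a j i = 0"
  using a_01[of i j] a_01[of j i] a_total[of i j] by (auto split: if_splits)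

text \<open>Counting arcs from both ends gives each ordered pair of distinct vertices total weight
  1.\<close>

lemma sum_d: "(\<Sum>i<n. d i) = real n * (real n - 1) / 2"
proof -
  have "2 * (\<Sum>i<n. d i) = (\<Sum>i<n. \<Sum>j<n. a i j) + (\<Sum>i<n. \<Sum>j<n. a j i)"
    by (subst (2) sum.swap) (simp add: d_def)
  also have "\<dots> = (\<Sum>i<n. \<Sum>j<n. 1 - (if i = j then 1 else 0))"
    by (auto simp: a_total simp flip: sum.distrib intro!: sum.cong)
  also have "\<dots> = real n * (real n - 1)"
    by (simp add: sum_subtractf)
  finally show ?thesis by simp
qed

lemma in_degree: "j < n \<Longrightarrow> (\<Sum>i<n. a i j) = real n - 1 - d j"
  by (simp add: a_flip[of j] d_def sum_subtractf)

text \<open>\<open>(d i)\<^sup>2\<close> counts pairs \<open>(j, k)\<close> of out-neighbours of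
  \<open>i\<close>. Pairs with j = k contribute \<open>d i\<close>; any other pair is joined by
  exactly one arc and so forms a transitive triple with source \<open>i\<close>, in one of two
  orders.\<close>

lemma transitive_triples:
  "(\<Sum>i<n. \<Sum>j<n. \<Sum>k<n. a i j * a j k * a i k) = ((\<Sum>i<n. (d i)\<^sup>2) - (\<Sum>i<n. d i)) / 2"
    (is "?t = _")
proof -
  have "(\<Sum>i<n. (d i)\<^sup>2) = (\<Sum>i<n. \<Sum>j<n. \<Sum>k<n. a i j * a i k)"
    by (simp add: d_def power2_eq_square sum_product)
  also have "\<dots> = (\<Sum>i<n. \<Sum>j<n. \<Sum>k<n. (if j = k then a i j else 0) +
      (a i j * a j k * a i k + a i k * a k j * a i j))"
  proof (intro sum.cong refl)
    fix i j k assume "j \<in> {..<n}" "k \<in> {..<n}"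
    then show "a i j * a i k = (if j = k then a i j else 0) +
        (a i j * a j k * a i k + a i k * a k j * a i j)"
      by (auto simp: a_flip[of j k] a_idem a_diag algebra_simps)
  qed
  also have "\<dots> = (\<Sum>i<n. d i) + (?t + (\<Sum>i<n. \<Sum>j<n. \<Sum>k<n. a i k * a k j * a i j))"
    by (simp add: sum.distrib d_def)
  also have "(\<Sum>i<n. \<Sum>j<n. \<Sum>k<n. a i k * a k j * a i j) = ?t"
    by (intro sum.cong refl sum.swap)
  finally show ?thesis by simp
qed

text \<open>A walk i -> j -> k never returns to \<open>i\<close> after two arcs, so it closes to a
  cyclic triple unless the arc i -> k makes it transitive. Walks are counted at their middle vertex
  as in-degree times out-degree. Each cyclic triangle is counted three times, once per starting
  vertex, as in the trace of the cube.\<close>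

lemma cyclic_triples:
  "(\<Sum>i<n. \<Sum>j<n. \<Sum>k<n. a i j * a j k * a k i) =
    (real n - 1 / 2) * (\<Sum>i<n. d i) - 3 / 2 * (\<Sum>i<n. (d i)\<^sup>2)"
proof -
  have "(\<Sum>i<n. \<Sum>j<n. \<Sum>k<n. a i j * a j k * a k i) =
      (\<Sum>i<n. \<Sum>j<n. \<Sum>k<n. a i j * a j k - a i j * a j k * a i k)"
  proof (intro sum.cong refl)
    fix i j k assume "i \<in> {..<n}" "j \<in> {..<n}" "k \<in> {..<n}"
    then show "a i j * a j k * a k i = a i j * a j k - a i j * a j k * a i k"
      using a_asym[of i j] by (auto simp: a_flip[of i k] a_diag algebra_simps)
  qed
  also have "\<dots> = (\<Sum>i<n. \<Sum>j<n. \<Sum>k<n. a i j * a j k) -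
      ((\<Sum>i<n. (d i)\<^sup>2) - (\<Sum>i<n. d i)) / 2"
    by (simp add: sum_subtractf transitive_triples)
  also have "(\<Sum>i<n. \<Sum>j<n. \<Sum>k<n. a i j * a j k) = (\<Sum>j<n. (\<Sum>i<n. a i j) * d j)"
    by (subst sum.swap) (simp add: d_def flip: sum_distrib_left sum_distrib_right)
  also have "\<dots> = (real n - 1) * (\<Sum>i<n. d i) - (\<Sum>i<n. (d i)\<^sup>2)"
    by (simp add: in_degree sum_subtractf sum_distrib_left power2_eq_square algebra_simps
        sum.distrib)
  finally show ?thesis by (simp add: field_simps)
qed

text \<open>The Laplacian before normalization; the scalar factor returns in
  \<open>spectral_power_sum_2\<close> and \<open>spectral_power_sum_3\<close>.\<close>

definition lap :: "nat \<Rightarrow> nat \<Rightarrow> real" where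
  "lap i j = (if i = j then d i else 0) - a i j"

lemma lap_trace_pow2: "(\<Sum>i<n. \<Sum>j<n. lap i j * lap j i) = (\<Sum>i<n. (d i)\<^sup>2)"
proof -
  have "(\<Sum>i<n. \<Sum>j<n. lap i j * lap j i) = (\<Sum>i<n. \<Sum>j<n. if i = j then (d i)\<^sup>2 else 0)"
    by (intro sum.cong refl) (auto simp: lap_def a_diag a_asym power2_eq_square)
  then show ?thesis by simp
qed

lemma lap_trace_pow3:
  "(\<Sum>i<n. \<Sum>j<n. \<Sum>k<n. lap i j * lap j k * lap k i) =
    (\<Sum>i<n. d i ^ 3 + 3 / 2 * (d i)\<^sup>2) - (real n - 1 / 2) * (real n * (real n - 1) / 2)"
proof -
  have "(\<Sum>i<n. \<Sum>j<n. \<Sum>k<n. lap i j * lap j k * lap k i) =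
      (\<Sum>i<n. \<Sum>j<n. \<Sum>k<n. (if i = j then if j = k then d i ^ 3 else 0 else 0) -
        a i j * a j k * a k i)"
  proof (intro sum.cong refl)
    fix i j k assume "i \<in> {..<n}" "j \<in> {..<n}" "k \<in> {..<n}"
    \<comment> \<open>If exactly two of the indices agree, the product contains two opposite arcs
      and vanishes. Three distinct indices give three factors of sign -1.\<close>
    then show "lap i j * lap j k * lap k i =
        (if i = j then if j = k then d i ^ 3 else 0 else 0) - a i j * a j k * a k i"
      using a_asym[of i j] a_asym[of j k] a_asym[of k i]
      by (auto simp: lap_def a_diag power3_eq_cube)
  qed
  also have "\<dots> = (\<Sum>i<n. \<Sum>j<n. if i = j then d i ^ 3 else 0) -
      (\<Sum>i<n. \<Sum>j<n. \<Sum>k<n. a i j * a j k * a k i)"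
  proof -
    have "(\<Sum>k<n. if i = j then if j = k then d i ^ 3 else 0 else 0) =
        (if i = j then d i ^ 3 else 0)" if "j < n" for i j
      using that by (cases "i = j") auto
    then show ?thesis by (simp add: sum_subtractf)
  qed
  \<comment> \<open>Subtracting the cyclic triples turns their -3/2 into the +3/2 on the squares;
    the other part is constant because the score sum is fixed.\<close>
  finally show ?thesis
    by (simp only: cyclic_triples sum.distrib sum_d flip: sum_distrib_left) simp
qed

end

section \<open>From tournaments to weights and power sums\<close>

lemma
  assumes "n_tournament n T"
  shows n_tournament_pverts: "pverts T = {..<n}"
    and n_tournament_pair_digraph: "pair_digraph T"
    and n_tournament_arcs:
      "i < n \<Longrightarrow> j < n \<Longrightarrow> i \<noteq> j \<Longrightarrow> ((i, j) \<in> parcs T) \<noteq> ((j, i) \<in> parcs T)"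
  using assms unfolding n_tournament_def by blast+

lemma score_eq_card:
  assumes "n_tournament n T"
  shows "score T i = card {j. j < n \<and> (i, j) \<in> parcs T}"
proof -
  interpret pair_digraph T by (rule n_tournament_pair_digraph[OF assms])
  have "out_arcs (with_proj T) i = Pair i ` {j. j < n \<and> (i, j) \<in> parcs T}"
    using n_tournament_pverts[OF assms] in_arcsD2 by auto
  then show ?thesis
    by (simp add: score_def out_degree_def card_image inj_on_def)
qed

lemma tournament_weights:
  assumes T: "n_tournament n T"
  shows "tournament_weights n (\<lambda>i j. if (i, j) \<in> parcs T then 1 else 0) (\<lambda>i. real (score T i))"
proof -
  interpret pair_digraph T by (rule n_tournament_pair_digraph[OF assms])
  have loop: "(i, i) \<notin> parcs T" for i using pair_no_loops[of "(i, i)"] by auto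
  show ?thesis
  proof
    fix i j assume "i < n" "j < n"
    from n_tournament_arcs[OF T this]
    show "(if (i, j) \<in> parcs T then 1 else 0) + (if (j, i) \<in> parcs T then 1 else 0) =
        (if i = j then 0 else 1 :: real)"
      using loop[of i] by (cases "i = j"; cases "(j, i) \<in> parcs T") simp_all
  next
    fix i
    have "{..<n} \<inter> {j. (i, j) \<in> parcs T} = {j. j < n \<and> (i, j) \<in> parcs T}" by auto
    then show "real (score T i) = (\<Sum>j<n. if (i, j) \<in> parcs T then 1 else 0)"
      by (simp add: score_eq_card[OF T] sum.If_cases)
  qed (auto simp: loop)
qed

lemma sum_scores:
  assumes "n_tournament n T"
  shows "(\<Sum>i<n. real (score T i)) = real n * (real n - 1) / 2"
  using tournament_weights.sum_d[OF tournament_weights[OF assms]] .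

lemma normalized_laplacian_carrier: "normalized_laplacian n T \<in> carrier_mat n n"
  unfolding normalized_laplacian_def score_mat_def adjacency_mat_def
  by (intro carrier_matI) simp_all

lemma spectral_power_sum_eq_trace:
  "spectral_power_sum k n T = complex_of_real (mat_trace (normalized_laplacian n T ^\<^sub>m k))"
  unfolding spectral_power_sum_def laplacian_spectrum_def
  by (rule sum_proots_char_poly_power_real[OF normalized_laplacian_carrier])

lemma
  fixes n :: nat
  assumes T: "n_tournament n T"
  defines "c \<equiv> inverse (real (n choose 2))"
  shows spectral_power_sum_2: "spectral_power_sum 2 n T =
      complex_of_real (c\<^sup>2 * (\<Sum>i<n. (real (score T i))\<^sup>2))"
    and spectral_power_sum_3: "spectral_power_sum 3 n T =
      complex_of_real (c ^ 3 * ((\<Sum>i<n. real (score T i) ^ 3 + 3 / 2 * (real (score T i))\<^sup>2) -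
        (real n - 1 / 2) * (real n * (real n - 1) / 2)))"
proof -
  interpret tournament_weights n "\<lambda>i j. if (i, j) \<in> parcs T then 1 else 0"
      "\<lambda>i. real (score T i)"
    by (rule tournament_weights[OF T])
  have entry: "normalized_laplacian n T $$ (i, j) = c * lap i j" if "i < n" "j < n" for i j
    using that
    by (simp add: normalized_laplacian_def score_mat_def adjacency_mat_def lap_def c_def)
  have "mat_trace (normalized_laplacian n T ^\<^sub>m 2) =
      c\<^sup>2 * (\<Sum>i<n. \<Sum>j<n. lap i j * lap j i)"
    by (simp add: mat_trace_pow2[OF normalized_laplacian_carrier] entry sum_distrib_left
        power2_eq_square mult_ac)
  then show "spectral_power_sum 2 n T = complex_of_real (c\<^sup>2 * (\<Sum>i<n. (real (score T i))\<^sup>2))"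
    by (simp only: spectral_power_sum_eq_trace lap_trace_pow2)
  have "mat_trace (normalized_laplacian n T ^\<^sub>m 3) =
      c ^ 3 * (\<Sum>i<n. \<Sum>j<n. \<Sum>k<n. lap i j * lap j k * lap k i)"
    by (simp add: mat_trace_pow3[OF normalized_laplacian_carrier] entry sum_distrib_left
        power3_eq_cube mult_ac)
  then show "spectral_power_sum 3 n T = complex_of_real (c ^ 3 *
      ((\<Sum>i<n. real (score T i) ^ 3 + 3 / 2 * (real (score T i))\<^sup>2) -
        (real n - 1 / 2) * (real n * (real n - 1) / 2)))"
    by (simp only: spectral_power_sum_eq_trace lap_trace_pow3)
qed

section \<open>Minimality of balanced scores\<close>

text \<open>No natural number lies strictly between \<open>k\<close> and \<open>k + 1\<close>. This
  is where integrality of the scores enters; for real \<open>x\<close> the product can be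
  negative.\<close>

lemma mult_pred_nonneg: "0 \<le> (real x - real k) * (real x - real k - 1)"
proof (cases "x \<le> k")
  case True
  then show ?thesis by (intro mult_nonpos_nonpos) auto
next
  case False
  then show ?thesis by (intro mult_nonneg_nonneg) auto
qed

lemma square_ge_secant: "real k ^ 2 + (real x - real k) * ((real k + 1)\<^sup>2 - real k ^ 2) \<le> real x ^ 2"
  using mult_pred_nonneg[of x k] by (simp add: power2_eq_square algebra_simps)

lemma cube_ge_secant: "real k ^ 3 + (real x - real k) * ((real k + 1) ^ 3 - real k ^ 3) \<le> real x ^ 3"
proof -
  \<comment> \<open>The cube minus its secant has roots k and k + 1; having no quadratic term, its
    third root is -(2k + 1).\<close>
  have "0 \<le> (real x - real k) * (real x - real k - 1) * (real x + 2 * real k + 1)"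
    by (intro mult_nonneg_nonneg mult_pred_nonneg) auto
  then show ?thesis by (simp add: power3_eq_cube algebra_simps)
qed

lemma sum_secant:
  fixes a b s :: real
  shows "(\<Sum>i<n. a + (x i - b) * s) = real n * a + ((\<Sum>i<n. x i) - real n * b) * s"
  by (simp add: sum.distrib sum_subtractf flip: sum_distrib_right)

text \<open>One condition for both parities: \<open>(n - 1) div 2\<close> is the regular score for
  odd \<open>n\<close> and the lower nearly-regular score for even \<open>n\<close> > 0. In an odd
  tournament the fixed score sum rules out the upper value.\<close>

definition balanced :: "nat \<Rightarrow> nat pair_pre_digraph \<Rightarrow> bool" where
  "balanced n T \<longleftrightarrow> (\<forall>i<n. score T i = (n - 1) div 2 \<or> score T i = (n - 1) div 2 + 1)"

lemma balanced_if_regular_or_nearly_regular: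
  assumes "n \<ge> 2"
    and "if odd n then regular_tournament n T else nearly_regular_tournament n T"
  shows "n_tournament n T \<and> balanced n T"
proof (cases "odd n")
  case True
  then show ?thesis
    using assms by (auto simp: regular_tournament_def balanced_def n_tournament_pverts)
next
  case False
  then obtain m where m: "n = 2 * m" by (auto elim: evenE)
  define A where "A = {v. v < n \<and> score T v = m - 1}"
  define B where "B = {v. v < n \<and> score T v = m}"
  have T: "n_tournament n T" and card: "card A = m" "card B = m"
    using False assms m
    by (auto simp: nearly_regular_tournament_def A_def B_def n_tournament_pverts)
  \<comment> \<open>Disjointness needs m > 0, since truncated subtraction makes \<open>m - 1\<close>
    equal to \<open>m\<close> at 0. Two disjoint classes of size m then exhaust the 2m
    vertices.\<close>
  have "finite A" "finite B" "A \<inter> B = {}"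
    using \<open>n \<ge> 2\<close> m by (auto simp: A_def B_def)
  then have "card (A \<union> B) = card {..<n}" using card m by (simp add: card_Un_disjoint)
  moreover have "A \<union> B \<subseteq> {..<n}" by (auto simp: A_def B_def)
  ultimately have "A \<union> B = {..<n}" by (intro card_subset_eq) auto
  then have "score T v = m - 1 \<or> score T v = m" if "v < n" for v
    using that by (auto simp: A_def B_def)
  moreover have "(n - 1) div 2 = m - 1" "m - 1 + 1 = m" using \<open>n \<ge> 2\<close> m by auto
  ultimately show ?thesis using T by (auto simp: balanced_def)
qed

text \<open>\<open>m\<close> is the sum over the scores of the secant of \<open>f\<close> through
  \<open>k\<close> and \<open>k + 1\<close>. An affine function sees only the score sum, so
  \<open>m\<close> is the same for all tournaments on \<open>n\<close> vertices; the secant bounds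
  \<open>f\<close> from below and meets it at balanced scores.\<close>

lemma
  fixes f :: "nat \<Rightarrow> real" and n :: nat
  defines "k \<equiv> (n - 1) div 2"
  defines "m \<equiv> real n * f k +
    (real n * (real n - 1) / 2 - real n * real k) * (f (k + 1) - f k)"
  assumes T: "n_tournament n T"
  shows sum_score_ge: "(\<And>x. f k + (real x - real k) * (f (k + 1) - f k) \<le> f x) \<Longrightarrow>
      m \<le> (\<Sum>i<n. f (score T i))"
    and sum_score_balanced: "balanced n T \<Longrightarrow> (\<Sum>i<n. f (score T i)) = m"
proof -
  have m: "m = (\<Sum>i<n. f k + (real (score T i) - real k) * (f (k + 1) - f k))"
    by (simp only: sum_secant m_def sum_scores[OF T])
  show "m \<le> (\<Sum>i<n. f (score T i))"
    if "\<And>x. f k + (real x - real k) * (f (k + 1) - f k) \<le> f x"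
    unfolding m by (intro sum_mono that)
  show "(\<Sum>i<n. f (score T i)) = m" if "balanced n T"
    unfolding m
  proof (intro sum.cong refl)
    fix i assume "i \<in> {..<n}"
    then have "score T i = k \<or> score T i = k + 1"
      using that by (simp add: balanced_def k_def)
    then show "f (score T i) = f k + (real (score T i) - real k) * (f (k + 1) - f k)" by auto
  qed
qed

section \<open>From minimal power sums to maximal entropy\<close>

lemma maximizes_renyi_entropyI:
  assumes "\<alpha> > 1" and T: "n_tournament n T"
    and eq: "\<And>S. n_tournament n S \<Longrightarrow> spectral_power_sum \<alpha> n S = complex_of_real (p S)"
    and pos: "p T > 0"
    and min: "\<And>S. n_tournament n S \<Longrightarrow> p T \<le> p S"
  shows "maximizes_renyi_entropy \<alpha> n T"
proof -
  have "renyi_defined \<alpha> n S \<and> renyi_entropy \<alpha> n S \<le> renyi_entropy \<alpha> n T"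
    if S: "n_tournament n S" for S
  proof
    \<comment> \<open>Positivity of the minimum makes the entropy defined for every
      tournament.\<close>
    have pS: "0 < p S" using pos min[OF S] by linarith
    then show "renyi_defined \<alpha> n S" by (simp add: renyi_defined_def eq[OF S])
    \<comment> \<open>The factor \<open>1 / (1 - real \<alpha>)\<close> is negative, so the smaller
      power sum has the larger entropy.\<close>
    have "log 2 (p T) \<le> log 2 (p S)" using pos min[OF S] pS by simp
    then show "renyi_entropy \<alpha> n S \<le> renyi_entropy \<alpha> n T"
      unfolding renyi_entropy_def eq[OF S] eq[OF T] Re_complex_of_real
      using \<open>\<alpha> > 1\<close> by (intro mult_left_mono_neg) auto
  qed
  then show ?thesis using T by (auto simp: maximizes_renyi_entropy_def)
qed

lemma maximizes_renyi_entropy_2: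
  assumes n: "n \<ge> 2" and T: "n_tournament n T" "balanced n T"
  shows "maximizes_renyi_entropy 2 n T"
proof (rule maximizes_renyi_entropyI[OF _ T(1) spectral_power_sum_2])
  let ?f = "\<lambda>x. (real x)\<^sup>2"
  let ?c = "inverse (real (n choose 2))"
  have c: "?c > 0" using n by simp
  show "?c\<^sup>2 * (\<Sum>i<n. ?f (score T i)) \<le> ?c\<^sup>2 * (\<Sum>i<n. ?f (score S i))"
    if S: "n_tournament n S" for S
    unfolding sum_score_balanced[OF T, of ?f]
    by (intro mult_left_mono sum_score_ge[OF S, of ?f])
      (use square_ge_secant[of "(n - 1) div 2"] in \<open>simp_all add: add.commute\<close>)
  have "\<exists>i<n. score T i \<noteq> 0"
  proof (rule ccontr)
    assume "\<not> ?thesis"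
    then have "(\<Sum>i<n. real (score T i)) = 0" by simp
    then show False using n sum_scores[OF T(1)] by simp
  qed
  then have "(\<Sum>i<n. ?f (score T i)) > 0"
    by (auto intro!: sum_pos2)
  then show "?c\<^sup>2 * (\<Sum>i<n. ?f (score T i)) > 0" using c by simp
qed auto

text \<open>Positivity of the least possible trace of the cubed Laplacian, up to scaling. Equality
  holds at n = 3, for the cyclic triangle.\<close>

lemma balanced_cubic_pos:
  fixes n :: nat and f :: "nat \<Rightarrow> real"
  defines "k \<equiv> (n - 1) div 2"
  assumes n: "n \<ge> 2" "n \<noteq> 3" and f: "f = (\<lambda>x. real x ^ 3 + 3 / 2 * (real x)\<^sup>2)"
  shows "(real n - 1 / 2) * (real n * (real n - 1) / 2) < real n * f k +
    (real n * (real n - 1) / 2 - real n * real k) * (f (k + 1) - f k)" (is "?l < ?r")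
proof (cases "odd n")
  case True
  then have k: "n = 2 * k + 1" unfolding k_def by (auto elim!: oddE)
  with n have "k \<ge> 2" by auto
  \<comment> \<open>For odd \<open>n\<close> the mean score is \<open>k\<close>, so the secant slope
    drops out; the factor \<open>real k - 1\<close> vanishes exactly at n = 3.\<close>
  have "?r - ?l = real n * real k / 2 * (2 * real k + 1) * (real k - 1)"
    unfolding f k by (simp add: field_simps power2_eq_square power3_eq_cube)
  also have "\<dots> > 0" using \<open>k \<ge> 2\<close> k by (intro mult_pos_pos) auto
  finally show ?thesis by simp
next
  case False
  then have k: "n = 2 * (k + 1)" unfolding k_def using n by (auto elim!: evenE)
  \<comment> \<open>For even \<open>n\<close> the mean score is k + 1/2, so \<open>f k\<close> and
    \<open>f (k + 1)\<close> get equal weight; the summand 1 keeps n = 2, where k = 0,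
    positive.\<close>
  have "?r - ?l = (real k + 1)\<^sup>2 * (2 * (real k)\<^sup>2 + 1)"
    unfolding f k by (simp add: field_simps power2_eq_square power3_eq_cube)
  also have "\<dots> > 0" by (intro mult_pos_pos) (auto simp: add_nonneg_pos)
  finally show ?thesis by simp
qed

lemma maximizes_renyi_entropy_3:
  assumes n: "n \<ge> 2" "n \<noteq> 3" and T: "n_tournament n T" "balanced n T"
  shows "maximizes_renyi_entropy 3 n T"
proof (rule maximizes_renyi_entropyI[OF _ T(1) spectral_power_sum_3])
  let ?f = "\<lambda>x. real x ^ 3 + 3 / 2 * (real x)\<^sup>2"
  let ?c = "inverse (real (n choose 2))"
  let ?e = "(real n - 1 / 2) * (real n * (real n - 1) / 2)"
  have c: "?c > 0" using n by simp
  \<comment> \<open>Secants are linear in the function, so the bounds for the cube and the square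
    add with weights 1 and 3/2.\<close>
  have secant: "?f k + (real x - real k) * (?f (k + 1) - ?f k) \<le> ?f x" for x k
  proof -
    have "?f k + (real x - real k) * (?f (k + 1) - ?f k) =
        (real k ^ 3 + (real x - real k) * ((real k + 1) ^ 3 - real k ^ 3)) +
        3 / 2 * ((real k)\<^sup>2 + (real x - real k) * ((real k + 1)\<^sup>2 - (real k)\<^sup>2))"
      by (simp add: field_simps)
    also have "\<dots> \<le> ?f x"
      by (intro add_mono mult_left_mono square_ge_secant cube_ge_secant) simp
    finally show ?thesis .
  qed
  show "?c ^ 3 * ((\<Sum>i<n. ?f (score T i)) - ?e) \<le> ?c ^ 3 * ((\<Sum>i<n. ?f (score S i)) - ?e)"
    if S: "n_tournament n S" for S
    unfolding sum_score_balanced[OF T, of ?f]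
    by (intro mult_left_mono diff_right_mono sum_score_ge[OF S, of ?f] secant) (use c in simp)
  have "(\<Sum>i<n. ?f (score T i)) - ?e > 0"
    unfolding sum_score_balanced[OF T, of ?f] using balanced_cubic_pos[OF n refl] by linarith
  then show "?c ^ 3 * ((\<Sum>i<n. ?f (score T i)) - ?e) > 0" using c by simp
qed auto

theorem corollary1:
  fixes n :: nat and T :: "nat pair_pre_digraph"
  assumes "n \<ge> 2"
    and "if odd n then regular_tournament n T else nearly_regular_tournament n T"
  shows "maximizes_renyi_entropy 2 n T \<and> (n \<noteq> 3 \<longrightarrow> maximizes_renyi_entropy 3 n T)"
  using balanced_if_regular_or_nearly_regular[OF assms] assms(1)
    maximizes_renyi_entropy_2 maximizes_renyi_entropy_3 by blast

end
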